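(* Let $d,m,k\in\mathbb{N}$ with $m>k\ge 2$, let $a_1,\ldots,a_m$ be distinct points of $\mathbb{R}^d$, and let $F\subset\mathbb{R}^d$ be a nonempty compact convex set with $0\in\operatorname{int}(F)$. Then the following properties are equivalent: (a) $S_k^F$ is compact. (b) $\displaystyle\min_{(x_1,\ldots,x_k)\in\mathbb{R}^{dk}}f_k^F(x_1,\ldots,x_k)<\min_{(x_1,\ldots,x_{k-1})\in\mathbb{R}^{d(k-1)}}f_{k-1}^F(x_1,\ldots,x_{k-1})$.
   Context: The Minkowski gauge function $\rho_F:\mathbb{R}^d\to[0,\infty)$ of $F$ is $\rho_F(x)=\inf\{t\ge 0\mid x\in tF\}$. For each $n\in\mathbb{N}$ with $1\le n\le m$, $f_n^F:\mathbb{R}^{dn}=(\mathbb{R}^d)^n\to\mathbb{R}$ is defined by $$f_n^F(x_1,\ldots,x_n)=\max_{1\le i\le m}\Big(\min_{1\le\ell\le n}\rho_F(x_\ell-a_i)\Big).$$ $S_k^F\subset\mathbb{R}^{dk}$ is the set of all global minimizers of $f_k^F$ over $\mathbb{R}^{dk}$. (The minima in (b) are attained.) *)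

theory Defs
  imports "HOL-Analysis.Analysis"
begin

definition minkowski_gauge :: "(real ^ 'd) set \<Rightarrow> real ^ 'd \<Rightarrow> real" where
  "minkowski_gauge F x = Inf {t. 0 \<le> t \<and> x \<in> (\<lambda>y. t *\<^sub>R y) ` F}"

text \<open>
  An \<open>n\<close>-tuple of points of \<open>\<real>\<^sup>d\<close> is a function on \<open>{1..n}\<close>, extended by \<open>undefined\<close>.
  The space of \<open>n\<close>-tuples carries the product topology, which is the Euclidean topology of
  \<open>\<real>\<close> to the power \<open>d n\<close>; it is a topology on a carrier set so that tuples of lengths \<open>k\<close> and
  \<open>k - 1\<close> can occur in the same statement.
\<close>

definition tuples :: "nat \<Rightarrow> (nat \<Rightarrow> real ^ 'd) set" where
  "tuples n = {1..n} \<rightarrow>\<^sub>E UNIV"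

definition tuple_topology :: "nat \<Rightarrow> (nat \<Rightarrow> real ^ 'd) topology" where
  "tuple_topology n = product_topology (\<lambda>_. euclidean) {1..n}"

lemma topspace_tuple_topology: "topspace (tuple_topology n) = tuples n"
  by (simp add: tuple_topology_def tuples_def)

text \<open>Meaningful for \<open>m, n \<ge> 1\<close> only, since \<open>Max\<close> and \<open>Min\<close> of the empty set are unspecified.\<close>

definition center_objective ::
    "(real ^ 'd) set \<Rightarrow> nat \<Rightarrow> (nat \<Rightarrow> real ^ 'd) \<Rightarrow> nat \<Rightarrow> (nat \<Rightarrow> real ^ 'd) \<Rightarrow> real" where
  "center_objective F m a n x =
     (MAX i\<in>{1..m}. MIN l\<in>{1..n}. minkowski_gauge F (x l - a i))"

definition center_solutions ::
    "(real ^ 'd) set \<Rightarrow> nat \<Rightarrow> (nat \<Rightarrow> real ^ 'd) \<Rightarrow> nat \<Rightarrow> (nat \<Rightarrow> real ^ 'd) set" where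
  "center_solutions F m a n =
     {x. is_arg_min (center_objective F m a n) (\<lambda>y. y \<in> tuples n) x}"

text \<open>
  The minimum, rather than the infimum, of the objective: \<open>LEAST\<close> is specified only if the
  minimum is attained.
\<close>

definition center_minimum ::
    "(real ^ 'd) set \<Rightarrow> nat \<Rightarrow> (nat \<Rightarrow> real ^ 'd) \<Rightarrow> nat \<Rightarrow> real" where
  "center_minimum F m a n = (LEAST v. v \<in> center_objective F m a n ` tuples n)"

end

theory Submission
  imports Defs
begin

text \<open>
  The gauge is continuous and comparable to the Euclidean norm, so a centre lying far from all the
  points \<open>a i\<close> serves none of them within the optimal radius. If all optimal \<open>k\<close>-tuples stay
  in a bounded set, this is because every centre is needed; if instead \<open>k - 1\<close> centres do as
  well as \<open>k\<close>, the last centre is free and the solution set is unbounded.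
\<close>

section \<open>The Minkowski gauge of a compact convex body around the origin\<close>

locale gauge_body =
  fixes F :: "(real ^ 'd) set"
  assumes compact_body: "compact F" and convex_body: "convex F" and zero_interior: "0 \<in> interior F"
begin

abbreviation \<rho> :: "real ^ 'd \<Rightarrow> real" where
  "\<rho> \<equiv> minkowski_gauge F"

lemma ball_subset_body:
  obtains r where "r > 0" "cball 0 r \<subseteq> F"
  using zero_interior mem_interior_cball by blast

text \<open>Rescaling \<open>x\<close> to norm \<open>r\<close> puts it in the ball inside
  \<open>F\<close>. Stated as membership, this gives both nonemptiness of the set under the infimum
  and the bound \<rho> x \<le> norm x / r.\<close>

lemma scale_mem:
  assumes "r > 0" "cball 0 r \<subseteq> F"
  shows "x \<in> (\<lambda>y. (norm x / r) *\<^sub>R y) ` F"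
proof (cases "x = 0")
  case True
  then show ?thesis
    using zero_interior interior_subset by force
next
  case False
  then have "(r / norm x) *\<^sub>R x \<in> F"
    using assms by (intro subsetD[OF assms(2)]) auto
  moreover have "x = (norm x / r) *\<^sub>R ((r / norm x) *\<^sub>R x)"
    using False assms by simp
  ultimately show ?thesis
    by (rule rev_image_eqI)
qed

lemma scales_nonempty: "{t. 0 \<le> t \<and> x \<in> (\<lambda>y. t *\<^sub>R y) ` F} \<noteq> {}"
proof -
  obtain r where "r > 0" "cball 0 r \<subseteq> F"
    using ball_subset_body .
  then show ?thesis
    using scale_mem[of r x] by (auto intro!: exI[of _ "norm x / r"])
qed

lemma gauge_le:
  assumes "0 \<le> t" "x \<in> (\<lambda>y. t *\<^sub>R y) ` F"
  shows "\<rho> x \<le> t"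
  unfolding minkowski_gauge_def
  by (rule cInf_lower) (use assms in \<open>auto intro: bdd_belowI[of _ 0]\<close>)

lemma gauge_greatest:
  assumes "\<And>t. 0 \<le> t \<Longrightarrow> x \<in> (\<lambda>y. t *\<^sub>R y) ` F \<Longrightarrow> b \<le> t"
  shows "b \<le> \<rho> x"
  unfolding minkowski_gauge_def
  by (rule cInf_greatest[OF scales_nonempty]) (use assms in auto)

text \<open>Convexity: if x = s u and y = t w with u, w in F, then x + y is s + t times a convex
  combination of u and w.\<close>

lemma gauge_triangle: "\<rho> (x + y) \<le> \<rho> x + \<rho> y"
proof -
  have sum: "\<rho> (x + y) \<le> s + t"
    if s: "0 \<le> s" "x \<in> (\<lambda>y. s *\<^sub>R y) ` F" and t: "0 \<le> t" "y \<in> (\<lambda>y. t *\<^sub>R y) ` F" for s t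
  proof (rule gauge_le)
    obtain u w where u: "u \<in> F" "x = s *\<^sub>R u" and w: "w \<in> F" "y = t *\<^sub>R w"
      using s t by blast
    show "x + y \<in> (\<lambda>y. (s + t) *\<^sub>R y) ` F"
    proof (cases "s + t = 0")
      case True
      then have "s = 0" "t = 0"
        using s t by auto
      then show ?thesis
        using u w by auto
    next
      case False
      then have "(s / (s + t)) *\<^sub>R u + (t / (s + t)) *\<^sub>R w \<in> F"
        using s t u w by (intro convexD[OF convex_body]) (auto simp: add_divide_distrib[symmetric])
      moreover have "x + y = (s + t) *\<^sub>R ((s / (s + t)) *\<^sub>R u + (t / (s + t)) *\<^sub>R w)"
        using False u w by (simp add: scaleR_add_right)
      ultimately show ?thesis
        by (rule rev_image_eqI)
    qed
  qed (use s t in auto)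
  \<comment> \<open>The infimum is taken over one scale at a time: first over \<open>s\<close> with
    \<open>t\<close> fixed, then over \<open>t\<close>.\<close>
  have "\<rho> (x + y) - t \<le> \<rho> x" if "0 \<le> t" "y \<in> (\<lambda>y. t *\<^sub>R y) ` F" for t
    by (rule gauge_greatest) (use sum that in \<open>force simp: algebra_simps\<close>)
  then have "\<rho> (x + y) - \<rho> x \<le> \<rho> y"
    by (intro gauge_greatest) (force simp: algebra_simps)
  then show ?thesis
    by simp
qed

text \<open>Subadditivity and the linear upper bound make the gauge Lipschitz. As \<rho> need not be
  symmetric, the difference is bounded in both orders.\<close>

lemma gauge_continuous: "continuous_on UNIV \<rho>"
proof -
  obtain r where r: "r > 0" "cball 0 r \<subseteq> F"
    using ball_subset_body .
  have le: "\<rho> x \<le> norm x / r" for x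
    using gauge_le[OF _ scale_mem[OF r]] r by simp
  have diff: "\<rho> x - \<rho> y \<le> norm (x - y) / r" for x y
    using gauge_triangle[of "x - y" y] le[of "x - y"] by simp
  have "(1 / r)-lipschitz_on UNIV \<rho>"
  proof (rule lipschitz_onI)
    show "dist (\<rho> x) (\<rho> y) \<le> 1 / r * dist x y" for x y
      using diff[of x y] diff[of y x] by (auto simp: dist_norm norm_minus_commute abs_le_iff)
  qed (use r in simp)
  then show ?thesis
    by (rule lipschitz_on_continuous_on)
qed

text \<open>If the ball of radius \<open>B\<close> contains \<open>F\<close>, every scale
  \<open>t\<close> with x in t F satisfies norm x \<le> t B.\<close>

lemma norm_le_gauge: "\<exists>B>0. \<forall>x. norm x \<le> B * \<rho> x"
proof -
  obtain B where B: "B > 0" "\<And>x. x \<in> F \<Longrightarrow> norm x \<le> B"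
    using compact_imp_bounded[OF compact_body] bounded_pos by blast
  have "norm x / B \<le> \<rho> x" for x
  proof (rule gauge_greatest)
    fix t :: real
    assume t: "0 \<le> t" "x \<in> (\<lambda>y. t *\<^sub>R y) ` F"
    then obtain y where "y \<in> F" "x = t *\<^sub>R y"
      by blast
    then show "norm x / B \<le> t"
      using B t by (simp add: divide_le_eq mult_left_mono)
  qed
  then have "norm x \<le> B * \<rho> x" for x
    using B by (simp add: divide_le_eq mult.commute)
  then show ?thesis
    using B by blast
qed

end

section \<open>Continuity of the objective and existence of minimizers\<close>

locale center_problem = gauge_body F for F :: "(real ^ 'd) set" +
  fixes m :: nat and a :: "nat \<Rightarrow> real ^ 'd"
  assumes m_pos: "1 \<le> m"
begin

abbreviation f :: "nat \<Rightarrow> (nat \<Rightarrow> real ^ 'd) \<Rightarrow> real" where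
  "f \<equiv> center_objective F m a"

text \<open>Replaces the max-min by a covering condition, the form in which objective values are
  estimated below.\<close>

lemma objective_le_iff:
  assumes "1 \<le> n"
  shows "f n x \<le> v \<longleftrightarrow> (\<forall>i\<in>{1..m}. \<exists>l\<in>{1..n}. \<rho> (x l - a i) \<le> v)"
proof -
  have "(MIN l\<in>{1..n}. \<rho> (x l - a i)) \<le> v \<longleftrightarrow> (\<exists>l\<in>{1..n}. \<rho> (x l - a i) \<le> v)" for i
    using assms by (subst Min_le_iff) auto
  then show ?thesis
    using m_pos unfolding center_objective_def by (subst Max_le_iff) auto
qed

lemma objective_continuous:
  assumes "1 \<le> n"
  shows "continuous_map (tuple_topology n) euclideanreal (f n)"
proof -
  have Min: "continuous_map X euclideanreal (\<lambda>x. MIN j\<in>J. g j x)"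
    if "finite J" "J \<noteq> {}" "\<And>j. j \<in> J \<Longrightarrow> continuous_map X euclideanreal (g j)"
    for J and X :: "'x topology" and g :: "nat \<Rightarrow> 'x \<Rightarrow> real"
    using that by (induction rule: finite_ne_induct) (auto intro!: continuous_map_real_min)
  have Max: "continuous_map X euclideanreal (\<lambda>x. MAX j\<in>J. g j x)"
    if "finite J" "J \<noteq> {}" "\<And>j. j \<in> J \<Longrightarrow> continuous_map X euclideanreal (g j)"
    for J and X :: "'x topology" and g :: "nat \<Rightarrow> 'x \<Rightarrow> real"
    using that by (induction rule: finite_ne_induct) (auto intro!: continuous_map_real_max)
  have "continuous_map (tuple_topology n) euclideanreal (\<lambda>x. \<rho> (x l - a i))" if "l \<in> {1..n}" for l i
  proof -
    have "continuous_map (tuple_topology n) euclidean (\<lambda>x. x l)"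
      unfolding tuple_topology_def using that by (rule continuous_map_product_projection)
    moreover have "continuous_map euclidean euclideanreal (\<lambda>y. \<rho> (y - a i))"
      by (auto intro!: continuous_on_compose2[OF gauge_continuous] continuous_intros)
    ultimately show ?thesis
      by (rule continuous_map_compose[unfolded o_def])
  qed
  then show ?thesis
    unfolding center_objective_def using assms m_pos by (intro Max Min) auto
qed

lemma compactin_box: "compactin (tuple_topology n) ({1..n} \<rightarrow>\<^sub>E cball 0 R)"
  unfolding tuple_topology_def by (subst compactin_PiE) auto

lemma near_centers_bounded: "\<exists>R\<ge>0. \<forall>i\<in>{1..m}. \<forall>x. \<rho> (x - a i) \<le> v \<longrightarrow> norm x \<le> R"
proof -
  obtain B where B: "B > 0" "\<And>x. norm x \<le> B * \<rho> x"
    using norm_le_gauge by blast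
  \<comment> \<open>The sum of norms dominates every \<open>norm (a i)\<close>, so \<open>R\<close>
    is independent of \<open>i\<close>; the absolute value keeps \<open>R\<close> nonnegative when
    \<open>v\<close> is negative.\<close>
  define R where "R = B * \<bar>v\<bar> + (\<Sum>i\<in>{1..m}. norm (a i))"
  have "norm x \<le> R" if "i \<in> {1..m}" "\<rho> (x - a i) \<le> v" for x i
  proof -
    have "B * \<rho> (x - a i) \<le> B * \<bar>v\<bar>"
      using that(2) B(1) by (intro mult_left_mono) auto
    then have "norm (x - a i) \<le> B * \<bar>v\<bar>"
      using B(2) order_trans by blast
    moreover have "norm (a i) \<le> (\<Sum>i\<in>{1..m}. norm (a i))"
      using that(1) by (intro member_le_sum) auto
    ultimately show ?thesis
      using norm_triangle_ineq[of "x - a i" "a i"] by (simp add: R_def)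
  qed
  moreover have "R \<ge> 0"
    using B by (auto simp: R_def intro!: add_nonneg_nonneg sum_nonneg)
  ultimately show ?thesis
    by blast
qed

text \<open>A minimizer over a compact box is global: a tuple no worse than a reference tuple
  \<open>z\<close> can be moved into the box without raising its value.\<close>

lemma minimizer_exists:
  assumes n: "1 \<le> n"
  obtains x where "x \<in> tuples n" "\<And>y. y \<in> tuples n \<Longrightarrow> f n x \<le> f n y"
proof -
  define z where "z = (\<lambda>l\<in>{1..n}. 0 :: real ^ 'd)"
  obtain R where R: "R \<ge> 0" "\<And>x i. i \<in> {1..m} \<Longrightarrow> \<rho> (x - a i) \<le> f n z \<Longrightarrow> norm x \<le> R"
    using near_centers_bounded[of "f n z"] by blast
  let ?K = "{1..n} \<rightarrow>\<^sub>E cball (0 :: real ^ 'd) R"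
  have z: "z \<in> ?K"
    using R by (auto simp: z_def)
  have "compact (f n ` ?K)"
    using image_compactin[OF compactin_box objective_continuous[OF n]] by simp
  then obtain x where x: "x \<in> ?K" "\<And>y. y \<in> ?K \<Longrightarrow> f n x \<le> f n y"
    using compact_attains_inf[of "f n ` ?K"] z by blast
  have "f n x \<le> f n y" if y: "y \<in> tuples n" for y
  proof (cases "f n y \<le> f n z")
    case False
    then show ?thesis
      using x(2)[OF z] by simp
  next
    case True
    \<comment> \<open>Centres outside the ball serve no point within \<open>f n z\<close>, so
      sending them to 0 loses nothing.\<close>
    define w where "w = (\<lambda>l\<in>{1..n}. if norm (y l) \<le> R then y l else 0)"
    have "w \<in> ?K"
      using R by (auto simp: w_def)
    moreover have "f n w \<le> f n y"
      unfolding objective_le_iff[OF n]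
    proof
      fix i
      assume i: "i \<in> {1..m}"
      then obtain l where l: "l \<in> {1..n}" "\<rho> (y l - a i) \<le> f n y"
        using iffD1[OF objective_le_iff[OF n] order.refl, of y] by blast
      then have "w l = y l"
        using R(2)[OF i] True by (simp add: w_def)
      then show "\<exists>l\<in>{1..n}. \<rho> (w l - a i) \<le> f n y"
        using l by metis
    qed
    ultimately show ?thesis
      using x(2) by fastforce
  qed
  moreover have "x \<in> tuples n"
    using x(1) by (auto simp: tuples_def PiE_iff)
  ultimately show thesis
    using that by blast
qed

text \<open>Attainment is what gives \<open>LEAST\<close> its value.\<close>

lemma center_minimum_eqI:
  assumes "x \<in> tuples n" "\<And>y. y \<in> tuples n \<Longrightarrow> f n x \<le> f n y"
  shows "center_minimum F m a n = f n x"
  unfolding center_minimum_def by (rule Least_equality) (use assms in auto)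

lemma center_minimum_attained:
  assumes "1 \<le> n"
  obtains x where "x \<in> tuples n" "f n x = center_minimum F m a n"
  using minimizer_exists[OF assms] center_minimum_eqI by metis

lemma center_minimum_le:
  assumes "1 \<le> n" "y \<in> tuples n"
  shows "center_minimum F m a n \<le> f n y"
  using minimizer_exists[OF assms(1)] center_minimum_eqI assms(2) by metis

text \<open>As a sublevel set, the solution set is closed by continuity, and membership becomes a
  covering condition.\<close>

lemma center_solutions_eq:
  assumes "1 \<le> n"
  shows "center_solutions F m a n = {x \<in> tuples n. f n x \<le> center_minimum F m a n}"
proof -
  obtain x where "x \<in> tuples n" "f n x = center_minimum F m a n"
    using center_minimum_attained[OF assms] by blast
  then show ?thesis
    using center_minimum_le[OF assms] by (fastforce simp: center_solutions_def is_arg_min_linorder)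
qed

section \<open>The strict inequality and compactness of the solution set\<close>

text \<open>A centre that serves no point within the optimal radius could be removed.\<close>

lemma all_centers_used:
  assumes k: "2 \<le> k" and less: "v < center_minimum F m a (k - 1)"
    and x: "f k x \<le> v" and l: "l \<in> {1..k}"
  shows "\<exists>i\<in>{1..m}. \<rho> (x l - a i) \<le> v"
proof (rule ccontr)
  assume unused: "\<not> (\<exists>i\<in>{1..m}. \<rho> (x l - a i) \<le> v)"
  define y where "y = (\<lambda>j\<in>{1..k - 1}. if j = l then x k else x j)"
  have served: "\<forall>i\<in>{1..m}. \<exists>j\<in>{1..k}. \<rho> (x j - a i) \<le> v"
    using x k objective_le_iff[of k x v] by simp
  have "f (k - 1) y \<le> v"
  proof (subst objective_le_iff)
    show "\<forall>i\<in>{1..m}. \<exists>j\<in>{1..k - 1}. \<rho> (y j - a i) \<le> v"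
    proof
      fix i
      assume i: "i \<in> {1..m}"
      then obtain j where j: "j \<in> {1..k}" "\<rho> (x j - a i) \<le> v"
        using served by blast
      have "j \<noteq> l"
        using unused i j by blast
      \<comment> \<open>The slot of \<open>y\<close> now holding \<open>x j\<close>; when
        \<open>j = k\<close>, \<open>j \<noteq> l\<close> ensures that \<open>l\<close> is at most
        \<open>k - 1\<close>.\<close>
      define j' where "j' = (if j = k then l else j)"
      have "j' \<in> {1..k - 1}" "y j' = x j"
        using \<open>j \<noteq> l\<close> j l by (auto simp: j'_def y_def)
      then show "\<exists>j\<in>{1..k - 1}. \<rho> (y j - a i) \<le> v"
        using j by metis
    qed
  qed (use k in simp)
  moreover have "y \<in> tuples (k - 1)"
    by (simp add: y_def tuples_def)
  then have "center_minimum F m a (k - 1) \<le> f (k - 1) y"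
    using k by (intro center_minimum_le) auto
  ultimately show False
    using less by linarith
qed

text \<open>Every centre of a solution serves some point, hence is bounded, so the solutions form a
  closed subset of a compact box.\<close>

lemma compact_solutions_if_less:
  assumes k: "2 \<le> k" and less: "center_minimum F m a k < center_minimum F m a (k - 1)"
  shows "compactin (tuple_topology k) (center_solutions F m a k)"
proof -
  let ?v = "center_minimum F m a k"
  have k1: "1 \<le> k"
    using k by simp
  obtain R where R: "R \<ge> 0" "\<And>x i. i \<in> {1..m} \<Longrightarrow> \<rho> (x - a i) \<le> ?v \<Longrightarrow> norm x \<le> R"
    using near_centers_bounded[of ?v] by blast
  have eq: "center_solutions F m a k = {x \<in> topspace (tuple_topology k). f k x \<in> {..?v}}"
    by (simp add: center_solutions_eq[OF k1] topspace_tuple_topology)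
  have "closedin (tuple_topology k) (center_solutions F m a k)"
    unfolding eq by (rule closedin_continuous_map_preimage[OF objective_continuous[OF k1]]) simp
  moreover have "center_solutions F m a k \<subseteq> {1..k} \<rightarrow>\<^sub>E cball 0 R"
  proof
    fix x
    assume "x \<in> center_solutions F m a k"
    then have x: "x \<in> tuples k" "f k x \<le> ?v"
      by (auto simp: center_solutions_eq[OF k1])
    have "norm (x l) \<le> R" if "l \<in> {1..k}" for l
      using all_centers_used[OF k less x(2) that] R by blast
    then show "x \<in> {1..k} \<rightarrow>\<^sub>E cball 0 R"
      using x(1) by (auto simp: tuples_def PiE_iff)
  qed
  ultimately show ?thesis
    using closed_compactin[OF compactin_box] by blast
qed

lemma less_if_compact_solutions:
  assumes k: "2 \<le> k" and comp: "compactin (tuple_topology k) (center_solutions F m a k)"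
  shows "center_minimum F m a k < center_minimum F m a (k - 1)"
proof (rule ccontr)
  assume "\<not> ?thesis"
  then have le: "center_minimum F m a (k - 1) \<le> center_minimum F m a k"
    by simp
  have k1: "1 \<le> k" "1 \<le> k - 1"
    using k by auto
  obtain x where x: "x \<in> tuples (k - 1)" "f (k - 1) x = center_minimum F m a (k - 1)"
    using center_minimum_attained[OF k1(2)] by blast
  have served: "\<forall>i\<in>{1..m}. \<exists>l\<in>{1..k - 1}. \<rho> (x l - a i) \<le> center_minimum F m a k"
    using x(2) le objective_le_iff[OF k1(2), of x "center_minimum F m a k"] by simp
  \<comment> \<open>Appending any \<open>y\<close> to an optimal \<open>(k - 1)\<close>-tuple keeps
    all points served within the \<open>k\<close>-centre optimum.\<close>
  have sol: "x(k := y) \<in> center_solutions F m a k" for y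
  proof -
    have "x(k := y) \<in> tuples k"
      using x(1) k by (auto simp: tuples_def PiE_iff extensional_def)
    moreover have "f k (x(k := y)) \<le> center_minimum F m a k"
      unfolding objective_le_iff[OF k1(1)]
    proof
      fix i
      assume "i \<in> {1..m}"
      then obtain l where "l \<in> {1..k - 1}" "\<rho> (x l - a i) \<le> center_minimum F m a k"
        using served by blast
      then show "\<exists>l\<in>{1..k}. \<rho> ((x(k := y)) l - a i) \<le> center_minimum F m a k"
        by (intro bexI[of _ l]) auto
    qed
    ultimately show ?thesis
      by (simp add: center_solutions_eq[OF k1(1)])
  qed
  \<comment> \<open>Projection to the free coordinate would make the whole space compact, but it is
    unbounded, its dimension being positive.\<close>
  have "continuous_map (tuple_topology k) euclidean (\<lambda>x :: nat \<Rightarrow> real ^ 'd. x k)"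
    unfolding tuple_topology_def using k by (intro continuous_map_product_projection) auto
  then have "compact ((\<lambda>x. x k) ` center_solutions F m a k)"
    using image_compactin[OF comp] by fastforce
  moreover have "(\<lambda>x. x k) ` center_solutions F m a k = UNIV"
    using sol by (auto intro!: image_eqI[where x = "x(k := _)"])
  ultimately show False
    by (metis not_bounded_UNIV compact_imp_bounded)
qed

end

theorem theorem2p7:
  fixes m k :: nat
    and a :: "nat \<Rightarrow> real ^ 'd"
    and F :: "(real ^ 'd) set"
  assumes "k < m" and "2 \<le> k"
    and "inj_on a {1..m}"
    and "F \<noteq> {}" and "compact F" and "convex F" and "0 \<in> interior F"
  shows "compactin (tuple_topology k) (center_solutions F m a k)
    \<longleftrightarrow> center_minimum F m a k < center_minimum F m a (k - 1)"
proof -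
  \<comment> \<open>\<open>m_pos\<close> follows from \<open>k < m\<close>.\<close>
  interpret center_problem F m a
    using assms by unfold_locales auto
  show ?thesis
    using compact_solutions_if_less less_if_compact_solutions assms by blast
qed

end
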